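(* For every integer $n\ge 2$, $$\mu(\mathbb{Z}_{n+1})<\frac12\sqrt{\,n+4\log(n-1)+7-4\log 2+\frac{10}{n}\,},$$ where $\log$ is the natural logarithm.
   Context: For the cyclic group $\mathbb{Z}_{n+1}=\{0,1,\dots,n\}$ (addition modulo $n+1$), let $$\mathcal{L}(\mathbb{Z}_{n+1})=\Big\{(x_1,\dots,x_n,-x_1-\cdots-x_n)\in\mathbb{Z}^{n+1}:\ x_1+2x_2+\cdots+nx_n\equiv 0 \pmod{n+1}\Big\}$$ (the Barnes lattice). Let $V=\{(\xi_1,\dots,\xi_n,-\xi_1-\cdots-\xi_n):\xi_i\in\mathbb{R}\}\subset\mathbb{R}^{n+1}$. The covering radius $\mu(\mathbb{Z}_{n+1})$ is the smallest $\mu$ such that every point of $V$ lies at Euclidean distance at most $\mu$ from some point of $\mathcal{L}(\mathbb{Z}_{n+1})$. *)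

theory Defs
  imports "HOL-Analysis.Analysis" "HOL-Number_Theory.Number_Theory"
begin

(* Vectors with n+1 entries are functions on {1..n+1}, extended by undefined
   outside that set. zero_sum_vec n x is (x_1, ..., x_n, - x_1 - ... - x_n);
   only the values of x on {1..n} matter. *)
definition zero_sum_vec :: "nat \<Rightarrow> (nat \<Rightarrow> 'a::ab_group_add) \<Rightarrow> nat \<Rightarrow> 'a" where
  "zero_sum_vec n x = (\<lambda>i\<in>{1..n+1}. if i \<le> n then x i else - (\<Sum>j=1..n. x j))"

definition barnes_lattice :: "nat \<Rightarrow> (nat \<Rightarrow> int) set" where
  "barnes_lattice n =
     {zero_sum_vec n x | x. [(\<Sum>i=1..n. int i * x i) = 0] (mod int (n + 1))}"

definition ambient_space :: "nat \<Rightarrow> (nat \<Rightarrow> real) set" where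
  "ambient_space n = {zero_sum_vec n \<xi> | \<xi>. True}"

definition eucl_dist :: "nat \<Rightarrow> (nat \<Rightarrow> real) \<Rightarrow> (nat \<Rightarrow> real) \<Rightarrow> real" where
  "eucl_dist n u v = L2_set (\<lambda>i. u i - v i) {1..n+1}"

definition covers :: "nat \<Rightarrow> real \<Rightarrow> bool" where
  "covers n r \<longleftrightarrow>
     (\<forall>p\<in>ambient_space n. \<exists>q\<in>barnes_lattice n. eucl_dist n p (\<lambda>i. real_of_int (q i)) \<le> r)"

(* LEAST on the reals is only meaningful when a minimum exists; that it does is
   covers_covering_radius and covering_radius_le below. *)
definition covering_radius :: "nat \<Rightarrow> real" where
  "covering_radius n = (LEAST r. covers n r)"

lemma covers_nonneg:
  assumes "covers n r" shows "0 \<le> r"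
proof -
  have "zero_sum_vec n (\<lambda>_. 0) \<in> ambient_space n"
    by (auto simp: ambient_space_def)
  then obtain q where "eucl_dist n (zero_sum_vec n (\<lambda>_. 0)) (\<lambda>i. real_of_int (q i)) \<le> r"
    using assms unfolding covers_def by blast
  then show ?thesis
    unfolding eucl_dist_def by (rule order_trans[OF L2_set_nonneg])
qed

lemma covers_exists: "\<exists>r. covers n r"
proof -
  define N where "N = real (n + 1)"
  have "covers n (N * N * N)"
    unfolding covers_def
  proof
    fix p assume "p \<in> ambient_space n"
    then obtain \<xi> where p: "p = zero_sum_vec n \<xi>" by (auto simp: ambient_space_def)
    define x where "x i = int (n + 1) * \<lfloor>\<xi> i / N\<rfloor>" for i
    have x: "\<bar>\<xi> i - real_of_int (x i)\<bar> \<le> N" for i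
    proof -
      have N: "N > 0" by (simp add: N_def)
      define f where "f = real_of_int \<lfloor>\<xi> i / N\<rfloor>"
      have "f \<le> \<xi> i / N" "\<xi> i / N \<le> f + 1"
        unfolding f_def by linarith+
      then have "f * N \<le> \<xi> i" "\<xi> i \<le> (f + 1) * N"
        using N by (simp_all only: pos_divide_le_eq pos_le_divide_eq)
      moreover have "real_of_int (x i) = f * N"
        by (simp add: x_def f_def N_def)
      moreover have "(f + 1) * N = f * N + N" by (simp add: distrib_right)
      ultimately show ?thesis by linarith
    qed
    have "int (n + 1) dvd (\<Sum>i=1..n. int i * x i)"
      by (rule dvd_sum) (simp add: x_def)
    then have "zero_sum_vec n x \<in> barnes_lattice n"
      by (auto simp: barnes_lattice_def cong_0_iff)
    moreover have "eucl_dist n p (\<lambda>i. real_of_int (zero_sum_vec n x i)) \<le> N * N * N"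
    proof -
      have "\<bar>p i - real_of_int (zero_sum_vec n x i)\<bar> \<le> N * N" if i: "i \<in> {1..n+1}" for i
      proof (cases "i \<le> n")
        case True
        have "N \<le> N * N" by (simp add: N_def)
        then show ?thesis using True i x[of i] by (simp add: p zero_sum_vec_def)
      next
        case False
        have "\<bar>\<Sum>j=1..n. real_of_int (x j) - \<xi> j\<bar> \<le> (\<Sum>j=1..n. N)"
          by (rule order_trans[OF sum_abs sum_mono]) (use x in \<open>simp add: abs_minus_commute\<close>)
        also have "\<dots> \<le> N * N" by (simp add: N_def)
        finally show ?thesis using False i
          by (simp add: p zero_sum_vec_def sum_subtractf)
      qed
      then have "(\<Sum>i\<in>{1..n+1}. \<bar>p i - real_of_int (zero_sum_vec n x i)\<bar>) \<le> (\<Sum>i\<in>{1..n+1}. N * N)"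
        by (rule sum_mono)
      also have "\<dots> = N * N * N" by (simp add: N_def)
      finally show ?thesis
        unfolding eucl_dist_def by (rule order_trans[OF L2_set_le_sum_abs])
    qed
    ultimately show "\<exists>q\<in>barnes_lattice n. eucl_dist n p (\<lambda>i. real_of_int (q i)) \<le> N * N * N"
      by blast
  qed
  then show ?thesis by blast
qed

lemma finite_barnes_near:
  "finite {q \<in> barnes_lattice n. eucl_dist n p (\<lambda>i. real_of_int (q i)) \<le> r}"
proof (rule finite_subset)
  show "finite (\<Pi>\<^sub>E i\<in>{1..n+1}. {\<lfloor>p i - r\<rfloor>..\<lceil>p i + r\<rceil>})"
    by (intro finite_PiE) auto
  show "{q \<in> barnes_lattice n. eucl_dist n p (\<lambda>i. real_of_int (q i)) \<le> r}
        \<subseteq> (\<Pi>\<^sub>E i\<in>{1..n+1}. {\<lfloor>p i - r\<rfloor>..\<lceil>p i + r\<rceil>})"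
  proof
    fix q assume "q \<in> {q \<in> barnes_lattice n. eucl_dist n p (\<lambda>i. real_of_int (q i)) \<le> r}"
    then have q: "q \<in> barnes_lattice n" and d: "eucl_dist n p (\<lambda>i. real_of_int (q i)) \<le> r"
      by auto
    have "q \<in> extensional {1..n+1}"
      using q by (auto simp: barnes_lattice_def zero_sum_vec_def)
    moreover have "q i \<in> {\<lfloor>p i - r\<rfloor>..\<lceil>p i + r\<rceil>}" if i: "i \<in> {1..n+1}" for i
    proof -
      have "(p i - real_of_int (q i))\<^sup>2 \<le> (\<Sum>i\<in>{1..n+1}. (p i - real_of_int (q i))\<^sup>2)"
        by (rule member_le_sum[OF i]) auto
      then have "\<bar>p i - real_of_int (q i)\<bar> \<le> eucl_dist n p (\<lambda>i. real_of_int (q i))"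
        unfolding eucl_dist_def L2_set_def by (intro real_le_rsqrt) simp
      then have "\<bar>p i - real_of_int (q i)\<bar> \<le> r" using d by linarith
      then show ?thesis unfolding atLeastAtMost_iff by linarith
    qed
    ultimately show "q \<in> (\<Pi>\<^sub>E i\<in>{1..n+1}. {\<lfloor>p i - r\<rfloor>..\<lceil>p i + r\<rceil>})"
      by (simp add: PiE_iff)
  qed
qed

lemma covers_Inf: "covers n (Inf {r. covers n r})"
proof -
  define m where "m = Inf {r. covers n r}"
  have "\<exists>q\<in>barnes_lattice n. eucl_dist n p (\<lambda>i. real_of_int (q i)) \<le> m"
    if p: "p \<in> ambient_space n" for p
  proof -
    define d where "d q = eucl_dist n p (\<lambda>i. real_of_int (q i))" for q :: "nat \<Rightarrow> int"
    have near: "\<exists>q\<in>barnes_lattice n. d q \<le> m + e" if "e > 0" for e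
    proof -
      have "{r. covers n r} \<noteq> {}" using covers_exists[of n] by blast
      moreover have "Inf {r. covers n r} < m + e" using that by (simp only: m_def)
      ultimately have "\<exists>r\<in>{r. covers n r}. r < m + e" by (rule cInf_lessD)
      then obtain r where r: "covers n r" "r < m + e" by blast
      obtain q where "q \<in> barnes_lattice n" "d q \<le> r"
        using r(1) p unfolding covers_def d_def by blast
      then have "d q \<le> m + e" using r(2) by linarith
      then show ?thesis using \<open>q \<in> barnes_lattice n\<close> by blast
    qed
    define F where "F = {q \<in> barnes_lattice n. d q \<le> m + 1}"
    have fin: "finite F" unfolding F_def d_def by (rule finite_barnes_near)
    have ne: "F \<noteq> {}" using near[of 1] by (auto simp: F_def)
    define q where "q = arg_min_on d F"
    have q: "q \<in> F" "\<And>q'. q' \<in> F \<Longrightarrow> d q \<le> d q'"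
      unfolding q_def by (rule arg_min_if_finite(1)[OF fin ne]) (rule arg_min_least[OF fin ne])
    have "d q \<le> m"
    proof (rule field_le_epsilon)
      fix e :: real assume "e > 0"
      then obtain q' where q': "q' \<in> barnes_lattice n" "d q' \<le> m + min e 1"
        using near[of "min e 1"] by auto
      then have "d q' \<le> m + 1" by linarith
      then have "d q \<le> d q'" using q' by (intro q(2)) (simp add: F_def)
      then show "d q \<le> m + e" using q'(2) by linarith
    qed
    moreover have "q \<in> barnes_lattice n" using q(1) by (simp add: F_def)
    ultimately show ?thesis by (auto simp: d_def)
  qed
  then show ?thesis unfolding m_def[symmetric] by (simp add: covers_def)
qed

lemma Inf_covers_le: "covers n r \<Longrightarrow> Inf {r. covers n r} \<le> r"
  by (rule cInf_lower) (auto intro: bdd_belowI covers_nonneg)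

lemma covering_radius_eq_Inf: "covering_radius n = Inf {r. covers n r}"
  unfolding covering_radius_def by (rule Least_equality) (rule covers_Inf, rule Inf_covers_le)

lemma covers_covering_radius: "covers n (covering_radius n)"
  by (simp only: covering_radius_eq_Inf covers_Inf)

lemma covering_radius_le: "covers n r \<Longrightarrow> covering_radius n \<le> r"
  by (simp only: covering_radius_eq_Inf Inf_covers_le)

end

theory Submission
  imports Defs
begin

text \<open>
  This is Babai's nearest-plane rounding, bounding the squared covering radius by a quarter of the
  sum of the squared Gram--Schmidt norms, for the basis of the Barnes lattice that consists of the
  second differences \<open>e\<^sub>k - 2 e\<^sub>k\<^sub>+\<^sub>1 + e\<^sub>k\<^sub>+\<^sub>2\<close> and one vector of first moment \<open>n + 1\<close>.
  A vector with vanishing sum and first moment is orthogonal to every affine function of the index.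
  Hence the Gram--Schmidt vector that lives on \<open>{1..m+1}\<close> is affine on \<open>{1..m}\<close> (the weights of
  least-squares linear extrapolation to \<open>m+1\<close>), of squared norm \<open>1 + (4 m + 2) / (m (m - 1))\<close>,
  and the last one is affine throughout, of squared norm \<open>12 (n + 1) / (n (n + 2))\<close>.
  Summing produces \<open>n + 4 H\<^sub>n\<^sub>-\<^sub>1\<close> up to bounded terms.
\<close>

section \<open>Power sums and extrapolation weights\<close>

lemma sum_of_nat_upto: "(\<Sum>i=1..m. real i) = real m * (real m + 1) / 2"
  by (induction m) (auto simp: field_simps)

lemma sum_of_nat_sq_upto:
  "(\<Sum>i=1..m. real i * real i) = real m * (real m + 1) * (2 * real m + 1) / 6"
  by (induction m) (auto simp: field_simps)

text \<open>For \<open>m \<ge> 2\<close>, the affine function of \<open>i\<close> whose sum and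
  first moment over \<open>{1..m}\<close> are those of a unit mass at \<open>m + 1\<close>. Its
  negative, with entry 1 appended at \<open>m + 1\<close>, is the Gram-Schmidt vector on
  \<open>{1..m+1}\<close>.\<close>

definition extrap_weight :: "nat \<Rightarrow> nat \<Rightarrow> real" where
  "extrap_weight m i = (6 * real i - 2 * real m - 4) / (real m * (real m - 1))"

text \<open>The weight is affine in \<open>i\<close>, so its pairing with \<open>u\<close> sees only
  the sum and the first moment of \<open>u\<close>. This yields both the norm of the weight and the
  orthogonality used in rounding.\<close>

lemma sum_mult_extrap_weight:
  "(\<Sum>i\<in>A. u i * extrap_weight m i)
     = (6 * (\<Sum>i\<in>A. real i * u i) - (2 * real m + 4) * (\<Sum>i\<in>A. u i)) / (real m * (real m - 1))"
  unfolding sum_distrib_left sum_subtractf[symmetric] sum_divide_distrib extrap_weight_def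
  by (intro sum.cong) (auto simp: algebra_simps)

lemma extrap_weight_moments:
  assumes "m \<ge> 2"
  shows "(\<Sum>i=1..m. extrap_weight m i) = 1"
    and "(\<Sum>i=1..m. real i * extrap_weight m i) = real m + 1"
    and "(\<Sum>i=1..m. (extrap_weight m i)\<^sup>2) = (4 * real m + 2) / (real m * (real m - 1))"
proof -
  have nz: "real m \<noteq> 0" "real m - 1 \<noteq> 0" using assms by auto
  show 0: "(\<Sum>i=1..m. extrap_weight m i) = 1"
    using sum_mult_extrap_weight[of "\<lambda>_. 1" m "{1..m}"] nz
    by (simp only: mult_1_left mult_1_right sum_of_nat_upto) (simp add: field_simps)
  show 1: "(\<Sum>i=1..m. real i * extrap_weight m i) = real m + 1"
    using sum_mult_extrap_weight[of real m "{1..m}"] nz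
    by (simp only: sum_of_nat_upto sum_of_nat_sq_upto) (simp add: field_simps)
  \<comment> \<open>Pairing the weight with itself reduces the square sum to the two moments just
    found: \<open>6 (m + 1) - (2 m + 4) = 4 m + 2\<close>.\<close>
  show "(\<Sum>i=1..m. (extrap_weight m i)\<^sup>2) = (4 * real m + 2) / (real m * (real m - 1))"
    unfolding power2_eq_square sum_mult_extrap_weight[of "extrap_weight m"] 0 1
    by (simp add: algebra_simps)
qed

section \<open>Nearest-plane rounding\<close>

text \<open>Induction on the dimension: the last coordinate is rounded and cleared, and the rest has
  vanishing moments again. Each step costs at most a quarter of a squared Gram-Schmidt norm.\<close>

lemma rounding_moment_zero:
  fixes f :: "nat \<Rightarrow> real"
  assumes "m \<ge> 2" "(\<Sum>i=1..m. f i) = 0" "(\<Sum>i=1..m. real i * f i) = 0"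
  shows "\<exists>x::nat \<Rightarrow> int. (\<Sum>i=1..m. x i) = 0 \<and> (\<Sum>i=1..m. int i * x i) = 0 \<and>
    (\<Sum>i=1..m. (f i - of_int (x i))\<^sup>2)
      \<le> 1/4 * (\<Sum>j=2..<m. 1 + (4 * real j + 2) / (real j * (real j - 1)))"
  using assms
proof (induction m arbitrary: f rule: nat_induct_at_least)
  case base
  \<comment> \<open>Two independent linear equations in two unknowns, so nothing is left to
    round.\<close>
  have "f 1 = 0" "f 2 = 0" using base by (auto simp: numeral_2_eq_2)
  then show ?case
    by (intro exI[of _ "\<lambda>_. 0"]) (simp add: numeral_2_eq_2)
next
  case (Suc m)
  define z where "z = round (f (Suc m))"
  define d where "d = f (Suc m) - of_int z"
  \<comment> \<open>The second difference \<open>(1, -2, 1)\<close> at \<open>m - 1\<close>,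
    \<open>m\<close>, \<open>m + 1\<close> without its last entry, hence with moments
    \<open>-1\<close> and \<open>-(m + 1)\<close> on \<open>{1..m}\<close>.\<close>
  define b :: "nat \<Rightarrow> int" where "b i = (if i = m - 1 then 1 else 0) - 2 * (if i = m then 1 else 0)" for i
  \<comment> \<open>Subtracting \<open>z\<close> times the second difference and \<open>d\<close>
    times the Gram-Schmidt vector removes \<open>z + d\<close>, the whole entry at
    \<open>m + 1\<close>. Both vectors have zero moments, so \<open>g\<close> keeps them on
    \<open>{1..m}\<close>.\<close>
  define g where "g i = f i - of_int z * of_int (b i) + d * extrap_weight m i" for i
  have d: "d\<^sup>2 \<le> 1/4"
  proof -
    have "\<bar>d\<bar> \<le> 1/2" unfolding d_def z_def
      using of_int_round_abs_le[of "f (Suc m)"] by (simp add: abs_minus_commute)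
    then have "\<bar>d\<bar>\<^sup>2 \<le> (1/2)\<^sup>2" by (intro power_mono) auto
    then show ?thesis by (simp add: power2_eq_square)
  qed
  have b0: "(\<Sum>i=1..m. b i) = -1"
    unfolding b_def sum_subtractf sum_distrib_left[symmetric] using Suc.hyps by simp
  have b1: "(\<Sum>i=1..m. int i * b i) = - int m - 1"
  proof -
    have "(\<Sum>i=1..m. int i * b i)
        = (\<Sum>i=1..m. if i = m - 1 then int i else 0) - 2 * (\<Sum>i=1..m. if i = m then int i else 0)"
      unfolding sum_distrib_left sum_subtractf[symmetric] b_def by (intro sum.cong) auto
    also have "\<dots> = - int m - 1" using Suc.hyps by (simp add: of_nat_diff)
    finally show ?thesis .
  qed
  have b0': "(\<Sum>i=1..m. real_of_int (b i)) = -1"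
    using arg_cong[OF b0, of real_of_int] by simp
  have b1': "(\<Sum>i=1..m. real i * real_of_int (b i)) = - real m - 1"
    using arg_cong[OF b1, of real_of_int] by simp
  note w = extrap_weight_moments[OF Suc.hyps]
  have g0: "(\<Sum>i=1..m. g i) = 0"
  proof -
    have "(\<Sum>i=1..m. g i)
        = (\<Sum>i=1..m. f i) - of_int z * (\<Sum>i=1..m. real_of_int (b i)) + d * (\<Sum>i=1..m. extrap_weight m i)"
      by (simp add: g_def sum.distrib sum_subtractf sum_distrib_left)
    also have "\<dots> = 0" unfolding b0' w using Suc.prems(1) by (simp add: d_def)
    finally show ?thesis .
  qed
  have g1: "(\<Sum>i=1..m. real i * g i) = 0"
  proof -
    have "(\<Sum>i=1..m. real i * g i)
        = (\<Sum>i=1..m. real i * f i) - of_int z * (\<Sum>i=1..m. real i * real_of_int (b i))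
          + d * (\<Sum>i=1..m. real i * extrap_weight m i)"
      unfolding sum_distrib_left sum_subtractf[symmetric] sum.distrib[symmetric] g_def
      by (intro sum.cong) (auto simp: algebra_simps)
    also have "\<dots> = 0" unfolding b1' w using Suc.prems(2) by (simp add: d_def algebra_simps)
    finally show ?thesis .
  qed
  obtain x :: "nat \<Rightarrow> int" where x: "(\<Sum>i=1..m. x i) = 0" "(\<Sum>i=1..m. int i * x i) = 0"
    "(\<Sum>i=1..m. (g i - of_int (x i))\<^sup>2)
      \<le> 1/4 * (\<Sum>j=2..<m. 1 + (4 * real j + 2) / (real j * (real j - 1)))"
    using Suc.IH[OF g0 g1] by blast
  have x': "(\<Sum>i=1..m. real_of_int (x i)) = 0" "(\<Sum>i=1..m. real i * real_of_int (x i)) = 0"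
    using arg_cong[OF x(1), of real_of_int] arg_cong[OF x(2), of real_of_int] by simp_all
  define y where "y i = (if i \<le> m then x i + z * b i else z)" for i
  have y0: "(\<Sum>i=1..Suc m. y i) = 0"
  proof -
    have "(\<Sum>i=1..m. y i) = (\<Sum>i=1..m. x i) + z * (\<Sum>i=1..m. b i)"
      unfolding sum_distrib_left sum.distrib[symmetric] y_def by (intro sum.cong) auto
    then show ?thesis unfolding x b0 by (simp add: y_def)
  qed
  have y1: "(\<Sum>i=1..Suc m. int i * y i) = 0"
  proof -
    have "(\<Sum>i=1..m. int i * y i) = (\<Sum>i=1..m. int i * x i) + z * (\<Sum>i=1..m. int i * b i)"
      unfolding sum_distrib_left sum.distrib[symmetric] y_def
      by (intro sum.cong) (auto simp: algebra_simps)
    then show ?thesis unfolding x b1 by (simp add: y_def algebra_simps)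
  qed
  have orth: "(\<Sum>i=1..m. (g i - of_int (x i)) * extrap_weight m i) = 0"
    unfolding sum_mult_extrap_weight
    by (simp only: right_diff_distrib sum_subtractf g0 g1 x') simp
  \<comment> \<open>Pythagoras: the error on \<open>{1..m}\<close> is \<open>g - x\<close> minus
    \<open>d\<close> times the weight, with vanishing cross term. The entry \<open>d\<close> at
    \<open>m + 1\<close> later supplies the summand 1.\<close>
  have "(\<Sum>i=1..m. (f i - of_int (y i))\<^sup>2)
      = (\<Sum>i=1..m. (g i - of_int (x i))\<^sup>2)
        - 2 * d * (\<Sum>i=1..m. (g i - of_int (x i)) * extrap_weight m i)
        + d\<^sup>2 * (\<Sum>i=1..m. (extrap_weight m i)\<^sup>2)"
    unfolding sum_distrib_left sum_subtractf[symmetric] sum.distrib[symmetric] y_def g_def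
    by (intro sum.cong) (auto simp: algebra_simps power2_eq_square)
  also have "\<dots> = (\<Sum>i=1..m. (g i - of_int (x i))\<^sup>2) + d\<^sup>2 * ((4 * real m + 2) / (real m * (real m - 1)))"
    unfolding orth w by simp
  finally have "(\<Sum>i=1..Suc m. (f i - of_int (y i))\<^sup>2)
      = (\<Sum>i=1..m. (g i - of_int (x i))\<^sup>2) + d\<^sup>2 * (1 + (4 * real m + 2) / (real m * (real m - 1)))"
    by (simp add: y_def d_def algebra_simps)
  also have "\<dots> \<le> 1/4 * (\<Sum>j=2..<m. 1 + (4 * real j + 2) / (real j * (real j - 1)))
      + 1/4 * (1 + (4 * real m + 2) / (real m * (real m - 1)))"
    using Suc.hyps by (intro add_mono x(3) mult_right_mono d) auto
  also have "\<dots> = 1/4 * (\<Sum>j=2..<Suc m. 1 + (4 * real j + 2) / (real j * (real j - 1)))"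
    using Suc.hyps by (simp add: algebra_simps)
  finally show ?case using y0 y1 by blast
qed

text \<open>Rounding the first moment to a multiple of \<open>m\<close> reduces to the case of
  vanishing moments; the added term is the squared norm of the affine Gram-Schmidt vector.\<close>

lemma rounding_zero_sum:
  fixes f :: "nat \<Rightarrow> real"
  assumes m: "m \<ge> 2" and f0: "(\<Sum>i=1..m. f i) = 0"
  shows "\<exists>x::nat \<Rightarrow> int. (\<Sum>i=1..m. x i) = 0 \<and> int m dvd (\<Sum>i=1..m. int i * x i) \<and>
    (\<Sum>i=1..m. (f i - of_int (x i))\<^sup>2)
      \<le> 1/4 * ((\<Sum>j=2..<m. 1 + (4 * real j + 2) / (real j * (real j - 1)))
               + 12 * real m / ((real m)\<^sup>2 - 1))"
proof -
  define S where "S = (\<Sum>i=1..m. real i * f i)"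
  \<comment> \<open>\<open>S / m\<close> is the coefficient of \<open>f\<close> along the
    Gram-Schmidt vector \<open>m * h\<close>, with \<open>h\<close> defined below.\<close>
  define z where "z = round (S / real m)"
  define T where "T = S - of_int z * real m"
  \<comment> \<open>The reciprocal of the sum of \<open>(i - (m + 1) / 2)\<^sup>2\<close> over
    \<open>{1..m}\<close>. It gives \<open>h\<close> first moment 1, and is then also the squared
    norm of \<open>h\<close>.\<close>
  define c where "c = 12 / (real m * ((real m)\<^sup>2 - 1))"
  define h where "h i = c * (real i - (real m + 1) / 2)" for i :: nat
  \<comment> \<open>The lattice vector \<open>m (e_2 - e_1)\<close>: zero sum and first moment
    exactly \<open>m\<close>.\<close>
  define b :: "nat \<Rightarrow> int" where
    "b i = int m * (if i = 2 then 1 else 0) - int m * (if i = 1 then 1 else 0)" for i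
  define g where "g i = f i - of_int z * of_int (b i) - T * h i" for i
  have m1: "(real m)\<^sup>2 > 1" using m by (intro one_less_power) auto
  have T: "T\<^sup>2 \<le> 1/4 * (real m)\<^sup>2"
  proof -
    have "\<bar>S / real m - of_int z\<bar> \<le> 1/2" unfolding z_def
      using of_int_round_abs_le[of "S / real m"] by (simp add: abs_minus_commute)
    moreover have "T = (S / real m - of_int z) * real m"
      using m by (simp add: T_def field_simps)
    ultimately have "\<bar>T\<bar> \<le> 1/2 * real m"
      by (simp only: abs_mult) (intro mult_mono, auto)
    then have "\<bar>T\<bar>\<^sup>2 \<le> (1/2 * real m)\<^sup>2" by (intro power_mono) auto
    then show ?thesis by (simp add: power2_eq_square)
  qed
  have h_mult: "(\<Sum>i=1..m. u i * h i)
      = c * ((\<Sum>i=1..m. real i * u i) - (real m + 1) / 2 * (\<Sum>i=1..m. u i))" for u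
    unfolding sum_distrib_left sum_subtractf[symmetric] h_def
    by (intro sum.cong) (auto simp: algebra_simps)
  have h0: "(\<Sum>i=1..m. h i) = 0"
    using h_mult[of "\<lambda>_. 1"] by (simp only: mult_1_left mult_1_right sum_of_nat_upto) simp
  have h1: "(\<Sum>i=1..m. real i * h i) = 1"
  proof -
    have "(\<Sum>i=1..m. real i * h i) = c * (real m * ((real m)\<^sup>2 - 1) / 12)"
      unfolding h_mult sum_of_nat_upto sum_of_nat_sq_upto
      by (simp add: field_simps power2_eq_square)
    moreover have "real m \<noteq> 0" "(real m)\<^sup>2 - 1 \<noteq> 0" using m m1 by linarith+
    then have "c * (real m * ((real m)\<^sup>2 - 1) / 12) = 1"
      unfolding c_def by simp
    ultimately show ?thesis by simp
  qed
  have h2: "(\<Sum>i=1..m. (h i)\<^sup>2) = c"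
    unfolding power2_eq_square h_mult[of h] h0 h1 by simp
  have b0: "(\<Sum>i=1..m. b i) = 0"
    unfolding b_def sum_subtractf sum_distrib_left[symmetric] using m by simp
  have b1: "(\<Sum>i=1..m. int i * b i) = int m"
  proof -
    have "(\<Sum>i=1..m. int i * b i)
        = (\<Sum>i=1..m. if i = 2 then 2 * int m else 0) - (\<Sum>i=1..m. if i = 1 then int m else 0)"
      unfolding sum_subtractf[symmetric] b_def by (intro sum.cong) auto
    also have "\<dots> = int m" using m by simp
    finally show ?thesis .
  qed
  have b0': "(\<Sum>i=1..m. real_of_int (b i)) = 0"
    using arg_cong[OF b0, of real_of_int] by simp
  have b1': "(\<Sum>i=1..m. real i * real_of_int (b i)) = real m"
    using arg_cong[OF b1, of real_of_int] by simp
  have g0: "(\<Sum>i=1..m. g i) = 0"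
  proof -
    have "(\<Sum>i=1..m. g i)
        = (\<Sum>i=1..m. f i) - of_int z * (\<Sum>i=1..m. real_of_int (b i)) - T * (\<Sum>i=1..m. h i)"
      by (simp add: g_def sum_subtractf sum_distrib_left)
    then show ?thesis unfolding b0' h0 f0 by simp
  qed
  have g1: "(\<Sum>i=1..m. real i * g i) = 0"
  proof -
    have "(\<Sum>i=1..m. real i * g i)
        = S - of_int z * (\<Sum>i=1..m. real i * real_of_int (b i)) - T * (\<Sum>i=1..m. real i * h i)"
      unfolding sum_distrib_left sum_subtractf[symmetric] g_def S_def
      by (intro sum.cong) (auto simp: algebra_simps)
    then show ?thesis unfolding b1' h1 by (simp add: T_def)
  qed
  obtain x :: "nat \<Rightarrow> int" where x: "(\<Sum>i=1..m. x i) = 0" "(\<Sum>i=1..m. int i * x i) = 0"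
    "(\<Sum>i=1..m. (g i - of_int (x i))\<^sup>2)
      \<le> 1/4 * (\<Sum>j=2..<m. 1 + (4 * real j + 2) / (real j * (real j - 1)))"
    using rounding_moment_zero[OF m g0 g1] by blast
  have x': "(\<Sum>i=1..m. real_of_int (x i)) = 0" "(\<Sum>i=1..m. real i * real_of_int (x i)) = 0"
    using arg_cong[OF x(1), of real_of_int] arg_cong[OF x(2), of real_of_int] by simp_all
  define y where "y i = x i + z * b i" for i
  have "(\<Sum>i=1..m. y i) = 0"
    by (simp only: y_def sum.distrib sum_distrib_left[symmetric] x b0 mult_zero_right add_0_left)
  moreover have "(\<Sum>i=1..m. int i * y i) = (\<Sum>i=1..m. int i * x i) + z * (\<Sum>i=1..m. int i * b i)"
    unfolding sum_distrib_left sum.distrib[symmetric] y_def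
    by (intro sum.cong) (auto simp: algebra_simps)
  then have "int m dvd (\<Sum>i=1..m. int i * y i)" unfolding x b1 by simp
  moreover have "(\<Sum>i=1..m. (f i - of_int (y i))\<^sup>2)
      \<le> 1/4 * ((\<Sum>j=2..<m. 1 + (4 * real j + 2) / (real j * (real j - 1)))
               + 12 * real m / ((real m)\<^sup>2 - 1))"
  proof -
    have orth: "(\<Sum>i=1..m. (g i - of_int (x i)) * h i) = 0"
      unfolding h_mult by (simp only: right_diff_distrib sum_subtractf g0 g1 x' diff_zero mult_zero_right)
    have "(\<Sum>i=1..m. (f i - of_int (y i))\<^sup>2)
        = (\<Sum>i=1..m. (g i - of_int (x i))\<^sup>2)
          + 2 * T * (\<Sum>i=1..m. (g i - of_int (x i)) * h i) + T\<^sup>2 * (\<Sum>i=1..m. (h i)\<^sup>2)"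
      unfolding sum_distrib_left sum.distrib[symmetric] y_def g_def
      by (intro sum.cong) (auto simp: algebra_simps power2_eq_square)
    also have "\<dots> = (\<Sum>i=1..m. (g i - of_int (x i))\<^sup>2) + T\<^sup>2 * c"
      unfolding orth h2 by simp
    also have "\<dots> \<le> 1/4 * (\<Sum>j=2..<m. 1 + (4 * real j + 2) / (real j * (real j - 1)))
        + 1/4 * (real m)\<^sup>2 * c"
      using m1 by (intro add_mono x(3) mult_right_mono T) (auto simp: c_def)
    also have "(real m)\<^sup>2 * c = 12 * real m / ((real m)\<^sup>2 - 1)"
      using m by (simp add: c_def power2_eq_square)
    then have "1/4 * (real m)\<^sup>2 * c = 1/4 * (12 * real m / ((real m)\<^sup>2 - 1))"
      by (simp only: mult.assoc)
    finally show ?thesis by (simp only: distrib_left)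
  qed
  ultimately show ?thesis by blast
qed

section \<open>Covering bound for the Barnes lattice\<close>

lemma covers_barnes:
  assumes "n \<ge> 1"
  shows "covers n (sqrt (1/4 * ((\<Sum>j=2..n. 1 + (4 * real j + 2) / (real j * (real j - 1)))
               + 12 * real (n + 1) / ((real (n + 1))\<^sup>2 - 1))))"
  unfolding covers_def
proof
  fix p assume "p \<in> ambient_space n"
  then obtain \<xi> where p: "p = zero_sum_vec n \<xi>" by (auto simp: ambient_space_def)
  have "(\<Sum>i=1..n. p i) = (\<Sum>i=1..n. \<xi> i)"
    unfolding p by (intro sum.cong) (auto simp: zero_sum_vec_def)
  then have "(\<Sum>i=1..n+1. p i) = 0" by (simp add: p zero_sum_vec_def)
  then obtain x :: "nat \<Rightarrow> int" where x: "(\<Sum>i=1..n+1. x i) = 0"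
    "int (n + 1) dvd (\<Sum>i=1..n+1. int i * x i)"
    "(\<Sum>i=1..n+1. (p i - of_int (x i))\<^sup>2)
      \<le> 1/4 * ((\<Sum>j=2..<n+1. 1 + (4 * real j + 2) / (real j * (real j - 1)))
               + 12 * real (n + 1) / ((real (n + 1))\<^sup>2 - 1))"
    using rounding_zero_sum[of "n + 1" p] assms by auto
  have q: "zero_sum_vec n x i = x i" if "i \<in> {1..n+1}" for i
  proof (cases "i \<le> n")
    case True
    then show ?thesis using that by (simp add: zero_sum_vec_def)
  next
    case False
    then have "i = n + 1" using that by auto
    moreover have "- (\<Sum>j=1..n. x j) = x (n + 1)" using x(1) by simp
    ultimately show ?thesis by (simp add: zero_sum_vec_def)
  qed
  \<comment> \<open>The last coordinate contributes a multiple of \<open>n + 1\<close>, so the full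
    first moment and that of the first \<open>n\<close> coordinates agree modulo
    \<open>n + 1\<close>.\<close>
  have "(\<Sum>i=1..n+1. int i * x i) = (\<Sum>i=1..n. int i * x i) + int (n + 1) * x (n + 1)"
    by simp
  then have "int (n + 1) dvd (\<Sum>i=1..n. int i * x i)"
    using x(2) by (metis dvd_add_left_iff dvd_triv_left)
  then have "zero_sum_vec n x \<in> barnes_lattice n"
    by (auto simp: barnes_lattice_def cong_0_iff)
  moreover have "eucl_dist n p (\<lambda>i. real_of_int (zero_sum_vec n x i))
      \<le> sqrt (1/4 * ((\<Sum>j=2..n. 1 + (4 * real j + 2) / (real j * (real j - 1)))
               + 12 * real (n + 1) / ((real (n + 1))\<^sup>2 - 1)))"
  proof -
    have "(\<Sum>i\<in>{1..n+1}. (p i - real_of_int (zero_sum_vec n x i))\<^sup>2)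
        = (\<Sum>i=1..n+1. (p i - of_int (x i))\<^sup>2)"
      by (intro sum.cong) (auto simp: q)
    moreover have "{2..<n+1} = {2..n}" by auto
    ultimately show ?thesis
      unfolding eucl_dist_def L2_set_def using x(3) by (simp only: real_sqrt_le_iff)
  qed
  ultimately show "\<exists>q\<in>barnes_lattice n. eucl_dist n p (\<lambda>i. real_of_int (q i))
      \<le> sqrt (1/4 * ((\<Sum>j=2..n. 1 + (4 * real j + 2) / (real j * (real j - 1)))
               + 12 * real (n + 1) / ((real (n + 1))\<^sup>2 - 1)))"
    by blast
qed

section \<open>Estimate of the sum of squared norms\<close>

text \<open>By partial fractions \<open>(4 j + 2) / (j (j - 1)) = 6 / (j - 1) - 2 / j\<close>. The
  term \<open>- 2 / n\<close> absorbs the telescoping part, leaving \<open>4 / n\<close> per step to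
  compare with the logarithm. Equality at \<open>n = 3\<close> fixes the constant
  \<open>7 - 4 ln 2\<close>.\<close>

lemma sum_gram_schmidt_le:
  assumes "n \<ge> 3"
  shows "(\<Sum>j=2..n. 1 + (4 * real j + 2) / (real j * (real j - 1)))
    \<le> real n + 4 * ln (real n - 1) + 7 - 4 * ln 2 - 2 / real n"
  using assms
proof (induction n rule: nat_induct_at_least)
  case base
  have "{2..3::nat} = {2, 3}" by auto
  then show ?case by simp
next
  case (Suc n)
  have "ln ((real n - 1) / real n) \<le> (real n - 1) / real n - 1"
    using Suc.hyps by (intro ln_le_minus_one) auto
  also have "\<dots> = - (1 / real n)" using Suc.hyps by (simp add: field_simps)
  finally have ln: "1 / real n \<le> ln (real n) - ln (real n - 1)"
    using Suc.hyps by (simp add: ln_div)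
  have "1 + (4 * real (Suc n) + 2) / (real (Suc n) * (real (Suc n) - 1))
      = 1 + 6 / real n - 2 / real (Suc n)"
    using Suc.hyps by (simp add: divide_simps) (simp add: algebra_simps)
  then show ?case using Suc ln by simp
qed

lemma sum_gram_schmidt_less:
  assumes "n \<ge> 2"
  shows "(\<Sum>j=2..n. 1 + (4 * real j + 2) / (real j * (real j - 1)))
      + 12 * real (n + 1) / ((real (n + 1))\<^sup>2 - 1)
    < real n + 4 * ln (real n - 1) + 7 - 4 * ln 2 + 10 / real n"
proof (cases "n = 2")
  case True
  \<comment> \<open>The preceding estimate of the sum fails at \<open>n = 2\<close>; here the claim
    is \<open>10.5 < 14 - 4 ln 2\<close>.\<close>
  then show ?thesis using ln2_le_25_over_36 by simp
next
  case False
  have "(real (n + 1))\<^sup>2 - 1 = real n * (real n + 2)"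
    by (simp add: power2_eq_square algebra_simps)
  then have "12 * real (n + 1) / ((real (n + 1))\<^sup>2 - 1) < 12 / real n"
    using assms by (simp add: divide_simps)
  \<comment> \<open>The part \<open>2 / n\<close> cancels against the \<open>- 2 / n\<close> in the
    estimate of the sum.\<close>
  moreover have "12 / real n = 10 / real n + 2 / real n" by (simp add: field_simps)
  moreover have "(\<Sum>j=2..n. 1 + (4 * real j + 2) / (real j * (real j - 1)))
      \<le> real n + 4 * ln (real n - 1) + 7 - 4 * ln 2 - 2 / real n"
    using sum_gram_schmidt_le[of n] False assms by linarith
  ultimately show ?thesis by linarith
qed

theorem theorem1p4:
  fixes n :: nat
  assumes "n \<ge> 2"
  shows "covering_radius n
         < 1 / 2 * sqrt (real n + 4 * ln (real n - 1) + 7 - 4 * ln 2 + 10 / real n)"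
proof -
  have "covering_radius n
      \<le> sqrt (1/4 * ((\<Sum>j=2..n. 1 + (4 * real j + 2) / (real j * (real j - 1)))
               + 12 * real (n + 1) / ((real (n + 1))\<^sup>2 - 1)))"
    using assms by (intro covering_radius_le covers_barnes) auto
  also have "\<dots> < sqrt (1/4 * (real n + 4 * ln (real n - 1) + 7 - 4 * ln 2 + 10 / real n))"
    using sum_gram_schmidt_less[OF assms] by (intro real_sqrt_less_mono mult_strict_left_mono) auto
  also have "\<dots> = 1 / 2 * sqrt (real n + 4 * ln (real n - 1) + 7 - 4 * ln 2 + 10 / real n)"
    unfolding real_sqrt_mult by (simp add: real_sqrt_divide)
  finally show ?thesis .
qed

end
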